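(* Let $w$ be a word over the alphabet $\{a,b\}$. Then $w\in F_\gamma$ (that is, the word $w\,b$ is a fixed point of the permutation $\gamma$ of $D_m$ for some $m\ge 1$) if and only if $w$ can be obtained by the algorithm GenGammaPath, i.e. if and only if there exist an integer $n\ge 0$ and an array $t=(t_0,\dots,t_n)$ of nonnegative integers with $t_0>0$ such that $w$ is the word $w_n$ returned by GenGammaPath$(t)$.
   Context: Words are over $\{a,b\}$; $\lambda$ is the empty word; $x^k$ is the concatenation of $k$ copies of $x$ (so $x^0=\lambda$). For a word $w=w_1\cdots w_m$: $\delta(w)=|w|_a-|w|_b$, where $|w|_a,|w|_b$ are the numbers of letters $a$ and $b$; the complement $\overline{w}$ exchanges $a$ and $b$ letterwise; the mirror is $\widetilde{w}=w_m\cdots w_1$; and $Sym(w)=\overline{w}_m\cdots\overline{w}_1$. Two words are conjugate if they have the form $uv$ and $vu$. A Dyck word of length $2m$ is a word $w$ of length $2m$ with $\delta(w)=0$ and $\delta(v)\ge 0$ for each prefix $v$ of $w$. $D_m$ is the set of words $w\,b$ with $w$ a Dyck word of length $2m$. By the Cycle Lemma, every word with $m$ letters $a$ and $m+1$ letters $b$ has a unique factorization $uv$ (with $v$ nonempty) such that $vu\in D_m$; in particular it has exactly one conjugate in $D_m$. The involution $\alpha:D_m\to D_m$ sends $w$ to the unique conjugate of $\widetilde{w}$ lying in $D_m$. The involution $\beta:D_m\to D_m$ sends $w_1\cdots w_{2m}\,b$ to $Sym(w_1\cdots w_{2m})\,b$. The permutation $\gamma$ of $D_m$ is $\gamma(w)=\alpha(\beta(w))$.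 $F_\gamma$ denotes the set of fixed points of $\gamma$ over all $m\ge 1$; here elements of $F_\gamma$ are written without their final letter $b$, i.e. a Dyck word $w$ of length $2m$, $m\ge1$, is said to belong to $F_\gamma$ when $\gamma(w\,b)=w\,b$. Algorithm GenGammaPath$(t)$, with input an array $t=(t_0,\dots,t_n)$ of nonnegative integers with $t_0>0$: Part A ($n$ even). Set $u_0=a^{t_0-1}$ and $w_0=a^{t_0}b^{t_0}$. For $i=1,2,\dots,n$: - if $i$ is even, $u_i=Sym(u_{i-1})\,(a\,w_{i-1})^{t_i}$ and $w_i=u_i\,a\,w_{i-1}\,b\,Sym(u_i)$; - if $i$ is odd, $u_i=Sym(u_{i-1})\,(b\,w_{i-1})^{t_i}$ and $w_i=u_i\,b\,w_{i-1}\,a\,Sym(u_i)$. Part B ($n$ odd). Set $u_0=b^{t_0-1}$ and $w_0=b^{t_0}a^{t_0}$. For $i=1,2,\dots,n$: - if $i$ is odd, $u_i=Sym(u_{i-1})\,(a\,w_{i-1})^{t_i}$ and $w_i=u_i\,a\,w_{i-1}\,b\,Sym(u_i)$; - if $i$ is even, $u_i=Sym(u_{i-1})\,(b\,w_{i-1})^{t_i}$ and $w_i=u_i\,b\,w_{i-1}\,a\,Sym(u_i)$. In both cases the algorithm returns $w_n$. *)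

theory Defs
  imports Main "HOL-Library.Sublist"
begin

datatype letter = A | B

type_synonym word = "letter list"

definition delta :: "word \<Rightarrow> int" where
  "delta w = int (count_list w A) - int (count_list w B)"

fun complement_letter :: "letter \<Rightarrow> letter" where
  "complement_letter A = B"
| "complement_letter B = A"

definition complement :: "word \<Rightarrow> word" where
  "complement w = map complement_letter w"

text \<open>The mirror of a word is \<^const>\<open>rev\<close>.\<close>

definition Sym :: "word \<Rightarrow> word" where
  "Sym w = rev (complement w)"

definition word_pow :: "word \<Rightarrow> nat \<Rightarrow> word" where
  "word_pow x k = concat (replicate k x)"

definition conjugate :: "word \<Rightarrow> word \<Rightarrow> bool" where
  "conjugate x y \<longleftrightarrow> (\<exists>u v. x = u @ v \<and> y = v @ u)"

definition dyck_word :: "nat \<Rightarrow> word \<Rightarrow> bool" where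
  "dyck_word m w \<longleftrightarrow>
     length w = 2 * m \<and> delta w = 0 \<and> (\<forall>v. prefix v w \<longrightarrow> delta v \<ge> 0)"

definition D :: "nat \<Rightarrow> word set" where
  "D m = {w @ [B] | w. dyck_word m w}"

text \<open>
  The maps \<open>alpha m\<close>, \<open>beta\<close> and \<open>gamma m\<close> are meant on \<open>D m\<close> only. For a word of \<open>D m\<close> the
  definite description in \<open>alpha\<close> is well-defined by the Cycle Lemma.
\<close>

definition alpha :: "nat \<Rightarrow> word \<Rightarrow> word" where
  "alpha m w = (THE v. v \<in> D m \<and> conjugate (rev w) v)"

definition beta :: "word \<Rightarrow> word" where
  "beta w = Sym (butlast w) @ [B]"

definition gamma :: "nat \<Rightarrow> word \<Rightarrow> word" where
  "gamma m w = alpha m (beta w)"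

text \<open>The elements of \<open>F_gamma\<close> are written without their final letter \<^const>\<open>B\<close>.\<close>

definition F_gamma :: "word set" where
  "F_gamma = {w. \<exists>m\<ge>1. dyck_word m w \<and> gamma m (w @ [B]) = w @ [B]}"

text \<open>
  \<open>gen_even t i\<close> and \<open>gen_odd t i\<close> are the pairs \<open>(u\<^sub>i, w\<^sub>i)\<close> computed for an array \<open>t\<close> whose
  last index \<open>n\<close> is even, respectively odd.
\<close>

primrec gen_even :: "nat list \<Rightarrow> nat \<Rightarrow> word \<times> word" where
  "gen_even t 0 =
     (word_pow [A] (t ! 0 - 1), word_pow [A] (t ! 0) @ word_pow [B] (t ! 0))"
| "gen_even t (Suc j) =
     (let (u', w') = gen_even t j; i = Suc j in
      if even i then
        (let u = Sym u' @ word_pow ([A] @ w') (t ! i) in (u, u @ [A] @ w' @ [B] @ Sym u))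
      else
        (let u = Sym u' @ word_pow ([B] @ w') (t ! i) in (u, u @ [B] @ w' @ [A] @ Sym u)))"

primrec gen_odd :: "nat list \<Rightarrow> nat \<Rightarrow> word \<times> word" where
  "gen_odd t 0 =
     (word_pow [B] (t ! 0 - 1), word_pow [B] (t ! 0) @ word_pow [A] (t ! 0))"
| "gen_odd t (Suc j) =
     (let (u', w') = gen_odd t j; i = Suc j in
      if odd i then
        (let u = Sym u' @ word_pow ([A] @ w') (t ! i) in (u, u @ [A] @ w' @ [B] @ Sym u))
      else
        (let u = Sym u' @ word_pow ([B] @ w') (t ! i) in (u, u @ [B] @ w' @ [A] @ Sym u)))"

definition GenGammaPath :: "nat list \<Rightarrow> word" where
  "GenGammaPath t =
     (let n = length t - 1 in if even n then snd (gen_even t n) else snd (gen_odd t n))"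

end

theory Submission
  imports Defs
begin

text \<open>
  By the Cycle Lemma, a Dyck word \<open>w\<close> is a fixed point iff \<open>w = x b y\<close> and
  \<open>complement w = y b x\<close> for some \<open>x\<close>, \<open>y\<close>. Comparing \<open>x b y\<close> with \<open>complement (y b x)\<close>
  leaves \<open>w = u a (complement v) b (complement u)\<close> with \<open>u a (complement v) = v a u\<close>, since for
  \<open>x\<close> shorter than \<open>y\<close> the prefix \<open>x b (complement x)\<close> would have negative height.
  The algorithm preserves such pairs \<open>(u, v)\<close>, the next pair being
  \<open>(u (a (complement w))^k, w)\<close>. Conversely, in any such pair with \<open>v\<close> nonempty, one has
  \<open>u = u' (a (complement v))^k\<close> with \<open>u'\<close> shorter than \<open>v\<close>. Then \<open>v\<close> itself has the form of a fixed
  point with first component \<open>u'\<close>; as \<open>v\<close> is a prefix of \<open>w\<close>, its heights are nonnegative as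
  well and the descent continues.
\<close>

section \<open>Words\<close>

lemma complement_letter_invol [simp]: "complement_letter (complement_letter x) = x"
  by (cases x) auto

lemma complement_Nil [simp]: "complement [] = []"
  and complement_Cons [simp]: "complement (x # xs) = complement_letter x # complement xs"
  and complement_append [simp]: "complement (xs @ ys) = complement xs @ complement ys"
  and complement_rev: "complement (rev xs) = rev (complement xs)"
  and length_complement [simp]: "length (complement xs) = length xs"
  by (auto simp: complement_def rev_map)

lemma complement_invol [simp]: "complement (complement w) = w"
  by (induction w) auto

lemma complement_eq_iff [simp]: "complement v = complement w \<longleftrightarrow> v = w"
  by (metis complement_invol)

lemma complement_neq_self: "w \<noteq> [] \<Longrightarrow> complement w \<noteq> w"
  by (cases w; cases "hd w") auto

lemma word_pow_0 [simp]: "word_pow x 0 = []"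
  and word_pow_Suc: "word_pow x (Suc k) = x @ word_pow x k"
  by (auto simp: word_pow_def)

lemma word_pow_Suc_right: "word_pow x (Suc k) = word_pow x k @ x"
  by (induction k) (auto simp: word_pow_Suc)

lemma complement_word_pow: "complement (word_pow x k) = word_pow (complement x) k"
  by (induction k) (auto simp: word_pow_Suc)

lemma rev_word_pow: "rev (word_pow x k) = word_pow (rev x) k"
  by (induction k) (auto simp: word_pow_Suc word_pow_Suc_right[symmetric])

section \<open>Heights of words and of their prefixes\<close>

lemma delta_Nil [simp]: "delta [] = 0"
  and delta_A [simp]: "delta (A # w) = delta w + 1"
  and delta_B [simp]: "delta (B # w) = delta w - 1"
  and delta_append [simp]: "delta (v @ w) = delta v + delta w"
  by (auto simp: delta_def)

lemma delta_complement [simp]: "delta (complement w) = - delta w"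
proof (induction w)
  case (Cons x w)
  then show ?case by (cases x) auto
qed simp

lemma delta_rev [simp]: "delta (rev w) = delta w"
  by (simp add: delta_def)

lemma delta_word_pow: "delta (word_pow x k) = int k * delta x"
  by (induction k) (auto simp: word_pow_Suc algebra_simps)

text \<open>Bounded on both sides because complementing turns the maximal height of a word into a
  lower bound; the algorithm complements at every stage.\<close>

definition heights_in :: "int \<Rightarrow> int \<Rightarrow> word \<Rightarrow> bool" where
  "heights_in l h w \<longleftrightarrow> (\<forall>v. prefix v w \<longrightarrow> l \<le> delta v \<and> delta v \<le> h)"

lemma heights_in_Nil: "heights_in l h [] \<longleftrightarrow> l \<le> 0 \<and> 0 \<le> h"
  by (simp add: heights_in_def)

lemma heights_in_append:
  "heights_in l h (x @ y) \<longleftrightarrow> heights_in l h x \<and> heights_in (l - delta x) (h - delta x) y"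
proof -
  have "heights_in (l - delta x) (h - delta x) y
        \<longleftrightarrow> (\<forall>v. prefix v y \<longrightarrow> l \<le> delta (x @ v) \<and> delta (x @ v) \<le> h)"
    by (auto simp: heights_in_def algebra_simps)
  then show ?thesis by (auto simp: heights_in_def prefix_append)
qed

lemma heights_in_Cons:
  "heights_in l h (x # y) \<longleftrightarrow> l \<le> 0 \<and> 0 \<le> h \<and> heights_in (l - delta [x]) (h - delta [x]) y"
  using heights_in_append[of l h "[x]" y]
  by (cases x) (auto simp: heights_in_def prefix_Cons)

lemma heights_in_complement: "heights_in l h (complement w) \<longleftrightarrow> heights_in (- h) (- l) w"
proof (induction w arbitrary: l h)
  case (Cons x w)
  then show ?case by (cases x) (auto simp: heights_in_Cons)
qed (auto simp: heights_in_Nil)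

lemma heights_in_mono: "heights_in l h w \<Longrightarrow> l' \<le> l \<Longrightarrow> h \<le> h' \<Longrightarrow> heights_in l' h' w"
  unfolding heights_in_def by force

section \<open>The Cycle Lemma\<close>

lemma conjugate_sym: "conjugate x y \<Longrightarrow> conjugate y x"
  by (auto simp: conjugate_def)

lemma conjugate_iff_rotate: "conjugate x y \<longleftrightarrow> (\<exists>n. y = rotate n x)"
proof
  assume "conjugate x y"
  then show "\<exists>n. y = rotate n x"
    unfolding conjugate_def by (metis rotate_append)
next
  assume "\<exists>n. y = rotate n x"
  then show "conjugate x y"
    unfolding conjugate_def by (metis rotate_drop_take append_take_drop_id)
qed

lemma conjugate_trans: "conjugate x y \<Longrightarrow> conjugate y z \<Longrightarrow> conjugate x z"
  unfolding conjugate_iff_rotate by (metis rotate_rotate)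

lemma D_props:
  assumes "v \<in> D m"
  shows "delta v = - 1" "strict_prefix u v \<Longrightarrow> delta u \<ge> 0"
proof -
  obtain w where w: "v = w @ [B]" "dyck_word m w" using assms by (auto simp: D_def)
  then show "delta v = - 1" by (simp add: dyck_word_def)
  show "delta u \<ge> 0" if "strict_prefix u v"
    using w that by (auto simp: dyck_word_def strict_prefix_def)
qed

text \<open>If \<open>v = x @ y\<close> and \<open>v' = y @ x\<close> with both factors nonempty,
  each factor is a proper prefix of a word in \<open>D m\<close>. So both heights are nonnegative,
  against the total of -1.\<close>

lemma D_conjugate_unique:
  assumes "v \<in> D m" "v' \<in> D m" "conjugate v v'"
  shows "v = v'"
proof -
  obtain x y where xy: "v = x @ y" "v' = y @ x"
    using assms(3) by (auto simp: conjugate_def)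
  show ?thesis
  proof (cases "x = [] \<or> y = []")
    case False
    then have "delta x \<ge> 0" "delta y \<ge> 0"
      using D_props(2)[OF assms(1), of x] D_props(2)[OF assms(2), of y] xy
      by (auto simp: strict_prefix_def)
    then show ?thesis using D_props(1)[OF assms(1)] xy by simp
  qed (use xy in auto)
qed

lemma D_conjugate_exists:
  assumes len: "length c = 2 * m + 1" and delta: "delta c = - 1"
  shows "\<exists>v \<in> D m. conjugate c v"
proof -
  let ?f = "\<lambda>i. delta (take i c)"
  have fin: "finite (?f ` {..length c})" by simp
  \<comment> \<open>The cut is made at the first minimum: minimality controls the prefixes inside
    \<open>v\<close>, and being first controls those reaching into \<open>u\<close>.\<close>
  define i where "i = (LEAST i. i \<le> length c \<and> ?f i = Min (?f ` {..length c}))"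
  have "Min (?f ` {..length c}) \<in> ?f ` {..length c}"
    by (rule Min_in) auto
  then have "\<exists>i. i \<le> length c \<and> ?f i = Min (?f ` {..length c})" by force
  then have i: "i \<le> length c" "?f i = Min (?f ` {..length c})"
    unfolding i_def by (metis (mono_tags, lifting) LeastI)+
  have min: "?f i \<le> ?f j" if "j \<le> length c" for j
    unfolding i(2) using that by (intro Min_le[OF fin]) auto
  have strict: "?f i < ?f j" if "j < i" for j
  proof -
    have "?f j \<noteq> ?f i"
      using not_less_Least[OF that[unfolded i_def]] that i by auto
    moreover have "?f i \<le> ?f j" using min that i(1) by simp
    ultimately show ?thesis by linarith
  qed
  define u v where "u = take i c" and "v = drop i c"
  have c: "c = u @ v" by (simp add: u_def v_def)
  have pre: "delta p \<ge> 0" if p: "strict_prefix p (v @ u)" for p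
  proof (cases "prefix p v")
    case True
    then have "prefix (u @ p) c" by (simp add: c)
    then have "u @ p = take (length (u @ p)) c" "length (u @ p) \<le> length c"
      by (metis append_eq_conv_conj prefix_def, metis prefix_length_le)
    then have "delta u \<le> delta (u @ p)" using min unfolding u_def by metis
    then show ?thesis by simp
  next
    case False
    then obtain q where q: "p = v @ q" "strict_prefix q u"
      using p unfolding strict_prefix_def prefix_append by auto
    then have "prefix q c" "length q < length u"
      using prefix_length_less by (auto simp: c strict_prefix_def)
    then have "q = take (length q) c" "length q < i"
      using i(1) by (auto simp: u_def prefix_def)
    \<comment> \<open>As \<open>delta u + delta v = - 1\<close>, the strict inequality lifts
      \<open>delta p = delta v + delta q\<close> to at least 0.\<close>
    then have "delta u < delta q" using strict unfolding u_def by metis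
    then show ?thesis using delta q by (simp add: c)
  qed
  have "v @ u \<noteq> []" using len c by auto
  then obtain w x where w: "v @ u = w @ [x]" by (metis rev_exhaust)
  have dvu: "delta (v @ u) = - 1" using delta c by simp
  have dw: "delta p \<ge> 0" if "prefix p w" for p
    using pre[of p] that unfolding w by (auto simp: strict_prefix_def prefix_def)
  have x: "x = B"
    using dw[of w] dvu unfolding w by (cases x) auto
  have "length w = 2 * m" using len w c by (metis add.commute add_left_cancel length_append length_append_singleton Suc_eq_plus1 add_right_cancel)
  then have "dyck_word m w"
    unfolding dyck_word_def using dw dvu w x by auto
  then have "v @ u \<in> D m" by (auto simp: D_def w x)
  moreover have "conjugate c (v @ u)" by (auto simp: conjugate_def c)
  ultimately show ?thesis by blast
qed

text \<open>The Cycle Lemma replaces the definite description by conjugacy. Only length and height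
  of \<open>w\<close> are asked, so it applies directly to values of \<open>beta\<close>.\<close>

lemma alpha_eq_iff:
  assumes "length w = 2 * m + 1" "delta w = - 1" "v \<in> D m"
  shows "alpha m w = v \<longleftrightarrow> conjugate (rev w) v"
proof -
  have uniq: "v = v'"
    if "v \<in> D m \<and> conjugate (rev w) v" "v' \<in> D m \<and> conjugate (rev w) v'" for v v'
    using that D_conjugate_unique conjugate_sym conjugate_trans by blast
  obtain v' where v': "v' \<in> D m" "conjugate (rev w) v'"
    using D_conjugate_exists[of "rev w" m] assms by auto
  then have "alpha m w = v'"
    unfolding alpha_def using uniq by (intro the_equality) auto
  then show ?thesis using uniq v' assms(3) by blast
qed

text \<open>The mirror of \<open>beta (w @ [B])\<close> is \<open>B # complement w\<close>, so a
  fixed point means that this word is conjugate to \<open>w @ [B]\<close>. The factor moved to the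
  end has the form \<open>B # y @ [B]\<close>, and \<open>x\<close> is the other one.\<close>

lemma gamma_fixed_iff:
  assumes "dyck_word m w" "m \<ge> 1"
  shows "gamma m (w @ [B]) = w @ [B] \<longleftrightarrow> (\<exists>x y. w = x @ [B] @ y \<and> complement w = y @ [B] @ x)"
proof -
  have w: "length w = 2 * m" "delta w = 0" "w \<noteq> []" 
    using assms by (auto simp: dyck_word_def)
  have b: "beta (w @ [B]) = rev (complement w) @ [B]" by (simp add: beta_def Sym_def)
  have "gamma m (w @ [B]) = w @ [B] \<longleftrightarrow> conjugate (B # complement w) (w @ [B])"
    unfolding gamma_def b
  proof (subst alpha_eq_iff)
    show "w @ [B] \<in> D m" using assms(1) by (auto simp: D_def)
  qed (use w in simp_all)
  also have "\<dots> \<longleftrightarrow> (\<exists>x y. w = x @ [B] @ y \<and> complement w = y @ [B] @ x)"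
  proof
    assume "conjugate (B # complement w) (w @ [B])"
    then obtain u v where uv: "B # complement w = u @ v" "w @ [B] = v @ u"
      by (auto simp: conjugate_def)
    show "\<exists>x y. w = x @ [B] @ y \<and> complement w = y @ [B] @ x"
    \<comment> \<open>With \<open>u\<close> empty, \<open>w\<close> would begin with
      \<open>B\<close> and go below 0; with \<open>u = [B]\<close>, \<open>w\<close> would equal its
      own complement.\<close>
    proof (cases "u = []")
      case True
      then have "w @ [B] = B # complement w" using uv by simp
      then have "prefix [B] w" using w(3) by (cases w) simp_all
      then have "delta [B] \<ge> 0" using assms(1) unfolding dyck_word_def by blast
      then show ?thesis by simp
    next
      case False
      then obtain p where p: "u = B # p" "complement w = p @ v" using uv by (cases u) auto
      have "p \<noteq> []"
      proof
        assume "p = []"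
        then have "complement w = v" "w @ [B] = v @ [B]" using p uv(2) by simp_all
        then show False using complement_neq_self[OF w(3)] by (simp only: append1_eq_conv)
      qed
      then obtain p' x where p': "p = p' @ [x]" by (metis rev_exhaust)
      have "w @ [B] = (v @ [B] @ p') @ [x]" using uv(2) unfolding p p' by simp
      then have "w = v @ [B] @ p'" "x = B" by (simp_all only: append1_eq_conv)
      then show ?thesis using p(2) p' by (intro exI[of _ v] exI[of _ p']) simp
    qed
  next
    assume "\<exists>x y. w = x @ [B] @ y \<and> complement w = y @ [B] @ x"
    then obtain x y where "w = x @ [B] @ y" "complement w = y @ [B] @ x" by blast
    then have "B # complement w = (B # y @ [B]) @ x" "w @ [B] = x @ (B # y @ [B])" by simp_all
    then show "conjugate (B # complement w) (w @ [B])" unfolding conjugate_def by (intro exI conjI)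
  qed
  finally show ?thesis .
qed

section \<open>The algorithm up to complement\<close>

text \<open>The words \<open>u\<^sub>i\<close> and \<open>w\<^sub>i\<close> of the algorithm, complemented whenever \<open>n - i\<close> is odd,
  so that every \<open>w\<^sub>i\<close> is a Dyck word.\<close>

primrec gen :: "nat list \<Rightarrow> nat \<Rightarrow> word \<times> word" where
  "gen t 0 = (word_pow [A] (t ! 0 - 1), word_pow [A] (t ! 0) @ word_pow [B] (t ! 0))"
| "gen t (Suc j) =
     (let (u', w') = gen t j; u = rev u' @ word_pow ([A] @ complement w') (t ! Suc j)
      in (u, u @ [A] @ complement w' @ [B] @ Sym u))"

text \<open>Consecutive stages are complemented with opposite parity. This turns
  \<open>Sym u'\<close> into \<open>rev u'\<close> and \<open>w'\<close> into
  \<open>complement w'\<close>, and merges the two branches of the recursion.\<close>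

lemma gen_even_eq:
  "gen_even t i = (if even i then gen t i else map_prod complement complement (gen t i))"
  by (induction i)
     (auto simp: Let_def Sym_def complement_rev complement_word_pow split: prod.splits)

lemma gen_odd_eq:
  "gen_odd t i = (if odd i then gen t i else map_prod complement complement (gen t i))"
  by (induction i)
     (auto simp: Let_def Sym_def complement_rev complement_word_pow split: prod.splits)

lemma GenGammaPath_eq: "GenGammaPath t = snd (gen t (length t - 1))"
  by (simp add: GenGammaPath_def gen_even_eq gen_odd_eq Let_def)

lemma gen_append: "i < length t \<Longrightarrow> gen (t @ s) i = gen t i"
  by (induction i) (auto simp: nth_append split: prod.splits)

text \<open>The hypothesis moves \<open>u\<close> past one factor, turning
  \<open>[A] @ complement w\<close> into \<open>w @ [A]\<close>; iterate.\<close>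

lemma word_pow_commute:
  assumes "u @ [A] @ complement w = w @ [A] @ u"
  shows "u @ word_pow ([A] @ complement w) k = word_pow (w @ [A]) k @ u"
proof (induction k)
  case (Suc k)
  have "u @ word_pow ([A] @ complement w) (Suc k) = (u @ [A] @ complement w) @ word_pow ([A] @ complement w) k"
    by (simp add: word_pow_Suc)
  also have "\<dots> = w @ [A] @ u @ word_pow ([A] @ complement w) k"
    using assms by simp
  also have "\<dots> = word_pow (w @ [A]) (Suc k) @ u"
    unfolding Suc by (simp add: word_pow_Suc)
  finally show ?case .
qed simp

text \<open>The witness \<open>v\<close> is empty at stage 0 and the previous word \<open>w'\<close>
  afterwards. The symmetries of \<open>u\<close> and \<open>v\<close> are carried along because they
  give the commutation relation of the next stage.\<close>

lemma gen_invariant: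
  assumes "t ! 0 > 0" "gen t i = (u, w)"
  shows "rev u = u \<and>
    (\<exists>v. w = u @ [A] @ complement v @ [B] @ complement u \<and> u @ [A] @ complement v = v @ [A] @ u \<and>
         Sym v = v)"
  using assms(2)
proof (induction i arbitrary: u w)
  case 0
  obtain k where k: "t ! 0 = Suc k" using assms(1) by (cases "t ! 0") auto
  have u: "u = word_pow [A] k" and w: "w = word_pow [A] (Suc k) @ word_pow [B] (Suc k)"
    using 0 k by auto
  have "rev u = u" unfolding u by (simp add: rev_word_pow)
  moreover have "u @ [A] = [A] @ u"
    unfolding u using word_pow_Suc[of "[A]" k] word_pow_Suc_right[of "[A]" k] by simp
  moreover have "w = u @ [A] @ [B] @ complement u"
    unfolding u w by (simp only: word_pow_Suc_right[of "[A]"] word_pow_Suc[of "[B]"]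
        complement_word_pow complement_Cons complement_Nil complement_letter.simps append.assoc)
  ultimately show ?case by (intro conjI exI[of _ "[]"]) (auto simp: Sym_def)
next
  case (Suc i)
  obtain u' w' where uw': "gen t i = (u', w')" by fastforce
  define k where "k = t ! Suc i"
  from Suc.IH[OF uw'] obtain v where pal: "rev u' = u'"
    and w': "w' = u' @ [A] @ complement v @ [B] @ complement u'"
    and comm: "u' @ [A] @ complement v = v @ [A] @ u'" and sym: "Sym v = v" by blast
  have u: "u = u' @ word_pow ([A] @ complement w') k"
    and w: "w = u @ [A] @ complement w' @ [B] @ Sym u"
    using Suc.prems uw' pal by (auto simp: Let_def k_def)
  have symw': "Sym w' = w'"
  proof -
    have "rev v = complement v" using sym by (metis Sym_def rev_rev_ident)
    moreover have "rev (complement u') = complement u'" using pal by (metis complement_rev)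
    ultimately show ?thesis using sym pal unfolding w' Sym_def by simp
  qed
  have "complement w' = complement u' @ [B] @ v @ [A] @ u'" unfolding w' by simp
  moreover have w'2: "w' = v @ [A] @ u' @ [B] @ complement u'"
    using comm unfolding w' by (metis append.assoc)
  \<comment> \<open>\<open>Sym\<close> fixes \<open>w'\<close> and \<open>v\<close> and sends
    \<open>u'\<close> to \<open>complement u'\<close>, so it reverses the order of the blocks of
    \<open>w'2\<close>. The result is the first part of
    \<open>u' @ [A] @ complement w'\<close>.\<close>
  moreover have "w' = u' @ [A] @ complement u' @ [B] @ v"
    using arg_cong[OF w'2, of Sym] sym symw' pal complement_rev[of u'] by (simp add: Sym_def)
  ultimately have comm': "u' @ [A] @ complement w' = w' @ [A] @ u'" by simp
  note pow = word_pow_commute[OF comm']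
  have revw': "rev w' = complement w'" using symw' by (metis Sym_def rev_rev_ident)
  have palu: "rev u = u"
    using pow[of k] unfolding u by (simp add: rev_word_pow pal complement_rev[symmetric] revw')
  have "u @ [A] @ complement w' = w' @ [A] @ u"
  proof -
    have "u @ [A] @ complement w' = u' @ word_pow ([A] @ complement w') (Suc k)"
      unfolding u word_pow_Suc_right by simp
    also have "\<dots> = w' @ [A] @ word_pow (w' @ [A]) k @ u'"
      unfolding pow by (simp add: word_pow_Suc)
    also have "\<dots> = w' @ [A] @ u" unfolding u pow ..
    finally show ?thesis .
  qed
  moreover have "Sym u = complement u" using palu by (metis Sym_def complement_rev)
  ultimately show ?case using palu symw' w by auto
qed

text \<open>The upper bound \<open>delta u + 1\<close> is what the next stage needs: after an
  initial \<open>A\<close>, the complemented word descends by at most \<open>delta u\<close> below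
  its start.\<close>

lemma gen_heights:
  assumes "t ! 0 > 0" "gen t i = (u, w)"
  shows "heights_in 0 (delta u) u \<and> heights_in 0 (delta u + 1) w \<and> delta w = 0 \<and> w \<noteq> []"
  using assms(2)
proof (induction i arbitrary: u w)
  case 0
  have pA: "heights_in 0 (int k) (word_pow [A] k)" for k
    by (induction k) (auto simp: word_pow_Suc heights_in_Nil heights_in_Cons intro: heights_in_mono)
  have pB: "heights_in (- int k) 0 (word_pow [B] k)" for k
    using pA[of k] heights_in_complement[of "- int k" 0 "word_pow [A] k"]
    by (simp add: complement_word_pow)
  have "heights_in 0 (int (t ! 0)) (word_pow [A] (t ! 0) @ word_pow [B] (t ! 0))"
    using pA pB by (simp add: heights_in_append delta_word_pow)
  then show ?case using 0 assms(1) pA[of "t ! 0 - 1"]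
    by (cases "t ! 0") (auto simp: delta_word_pow word_pow_Suc add.commute)
next
  case (Suc i)
  obtain u' w' where uw': "gen t i = (u', w')" by fastforce
  define k where "k = t ! Suc i"
  have pal': "rev u' = u'" and pal: "rev u = u"
    using gen_invariant[OF assms(1)] uw' Suc.prems by blast+
  have symu: "Sym u = complement u" using pal by (metis Sym_def complement_rev)
  have u: "u = u' @ word_pow ([A] @ complement w') k"
    and w: "w = u @ [A] @ complement w' @ [B] @ complement u"
    using Suc.prems uw' pal' symu by (auto simp: Let_def k_def)
  define d where "d = delta u'"
  have IH: "heights_in 0 d u'" "heights_in 0 (d + 1) w'" "delta w' = 0"
    using Suc.IH[OF uw'] by (auto simp: d_def)
  have d0: "d \<ge> 0" using IH(1) by (auto simp: heights_in_def)
  have step: "heights_in (- e) 1 ([A] @ complement w')" if "e \<ge> d" for e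
    using heights_in_mono[OF IH(2), of 0 "e + 1"] that d0
    by (simp add: heights_in_Cons heights_in_complement add.commute)
  \<comment> \<open>Each copy has height 1, so the copy appended to \<open>k\<close> others starts
    at height \<open>k\<close>.\<close>
  have pow: "heights_in (- d) (int k) (word_pow ([A] @ complement w') k)" for k
  proof (induction k)
    case (Suc k)
    show ?case unfolding word_pow_Suc_right heights_in_append[of _ _ "word_pow _ _"]
      using heights_in_mono[OF Suc, of "- d" "int (Suc k)"] step[of "d + int k"] IH(3)
      by (simp add: delta_word_pow)
  qed (use d0 in \<open>auto simp: heights_in_Nil\<close>)
  have du: "delta u = d + int k" unfolding u by (simp add: delta_word_pow d_def IH(3))
  have hu: "heights_in 0 (delta u) u"
    unfolding du unfolding u heights_in_append
    using heights_in_mono[OF IH(1), of 0 "d + int k"] pow[of k] by (simp add: d_def[symmetric])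
  have hw: "heights_in 0 (delta u + 1) w"
    unfolding w heights_in_append[of _ _ u] 
  proof (intro conjI)
    show "heights_in 0 (delta u + 1) u" using hu by (rule heights_in_mono) auto
    have "heights_in (- delta u) 1 (([A] @ complement w') @ [B] @ complement u)"
      unfolding heights_in_append[of _ _ "[A] @ _"]
      using step[of "delta u"] heights_in_mono[OF hu, of "- 1" "delta u"] du d0 IH(3)
      by (simp add: heights_in_Cons heights_in_complement algebra_simps)
    then show "heights_in (0 - delta u) (delta u + 1 - delta u) ([A] @ complement w' @ [B] @ complement u)"
      by simp
  qed
  show ?case using hu hw IH(3) unfolding w by auto
qed

lemma gen_in_F_gamma:
  assumes "t ! 0 > 0"
  shows "snd (gen t i) \<in> F_gamma"
proof -
  obtain u w where uw: "gen t i = (u, w)" by fastforce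
  from gen_invariant[OF assms uw] obtain v
    where w: "w = u @ [A] @ complement v @ [B] @ complement u"
      and comm: "u @ [A] @ complement v = v @ [A] @ u" by blast
  have h: "heights_in 0 (delta u + 1) w" "delta w = 0" "w \<noteq> []"
    using gen_heights[OF assms uw] by auto
  \<comment> \<open>For height 0 this makes the length even, with \<open>m\<close> the number of
    letters \<open>A\<close>.\<close>
  have "delta w = 2 * int (count_list w A) - int (length w)" for w
  proof (induction w)
    case (Cons x w)
    then show ?case by (cases x) auto
  qed simp
  then have len: "length w = 2 * count_list w A" using h(2) by presburger
  have dyck: "dyck_word (count_list w A) w"
    using h len by (auto simp: dyck_word_def heights_in_def)
  have w2: "w = (v @ [A] @ u) @ [B] @ complement u"
    using comm unfolding w by (metis append.assoc)
  have "complement w = complement u @ [B] @ (v @ [A] @ u)"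
    using comm by (simp add: w)
  moreover have "count_list w A \<ge> 1" using h(3) len by (cases "count_list w A") auto
  ultimately have "gamma (count_list w A) (w @ [B]) = w @ [B]"
    using gamma_fixed_iff[OF dyck] w2 by blast
  then show ?thesis
    using dyck \<open>count_list w A \<ge> 1\<close> uw unfolding F_gamma_def by auto
qed

section \<open>Descent\<close>

text \<open>Levi's lemma for two marked letters: \<open>s\<close> is the stretch between the marks
  \<open>c\<close> and \<open>d\<close>.\<close>

lemma append_Cons_eq_split:
  assumes "x @ [c] @ y = x' @ [d] @ y'" "length x < length x'"
  obtains s where "x' = x @ [c] @ s" "y = s @ [d] @ y'"
proof -
  obtain us where us: "x' = x @ us" "[c] @ y = us @ [d] @ y'"
    using assms unfolding append_eq_append_conv2 by auto
  obtain e s where "us = e # s" using us(1) assms(2) by (cases us) simp_all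
  then show thesis using us that by simp
qed

text \<open>Two factorizations of \<open>w\<close>, one marked by \<open>B\<close> and one by
  \<open>A\<close>, are compared by the position of the mark. Equal positions would identify
  \<open>B\<close> with \<open>A\<close>.\<close>

lemma split_fixed_word:
  assumes w: "w = x @ [B] @ y" "complement w = y @ [B] @ x"
    and nonneg: "\<And>v. prefix v w \<Longrightarrow> delta v \<ge> 0"
  shows "\<exists>u v. y = complement u \<and> x = u @ [A] @ complement v \<and> x = v @ [A] @ u"
proof -
  have eq: "x @ [B] @ y = complement y @ [A] @ complement x"
    using w(1) arg_cong[OF w(2), of complement] by simp
  consider "length x < length y" | "length x = length y" | "length x > length y" by linarith
  then show ?thesis
  proof cases
    case 1
    then obtain s where "complement y = x @ [B] @ s"
      using append_Cons_eq_split[OF eq] 1 by (metis length_complement)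
    then have "complement (complement y) = complement (x @ [B] @ s)" by (rule arg_cong)
    then have "y = complement x @ [A] @ complement s" by simp
    \<comment> \<open>The heights of \<open>x\<close> and \<open>complement x\<close> cancel, so
      this prefix has height -1.\<close>
    then have "prefix (x @ [B] @ complement x) w" unfolding w(1) by simp
    then have "delta (x @ [B] @ complement x) \<ge> 0" by (rule nonneg)
    then show ?thesis by simp
  next
    case 2
    then show ?thesis using eq by auto
  next
    case 3
    then obtain s where s: "x = complement y @ [A] @ s" "complement x = s @ [B] @ y"
      using append_Cons_eq_split[OF eq[symmetric]] 3 by (metis length_complement)
    \<comment> \<open>The second expression for \<open>x\<close>; it yields the witnesses
      \<open>u = complement y\<close> and \<open>v = complement s\<close>.\<close>
    from s(2) have "complement (complement x) = complement (s @ [B] @ y)" by (rule arg_cong)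
    then have "x = complement s @ [A] @ complement y" by simp
    then show ?thesis using s(1) by (intro exI[of _ "complement y"] exI[of _ "complement s"]) simp
  qed
qed

text \<open>A division with remainder: while \<open>u\<close> is longer than \<open>v\<close>,
  cancelling a right factor \<open>[A] @ complement v\<close> preserves the relation. Equal lengths
  would give \<open>complement v = v\<close>, impossible for nonempty \<open>v\<close>.\<close>

lemma reduce_commuting:
  assumes "u @ [A] @ complement v = v @ [A] @ u" "v \<noteq> []"
  shows "\<exists>u1 k. length u1 < length v \<and> u = u1 @ word_pow ([A] @ complement v) k \<and>
                 u1 @ [A] @ complement v = v @ [A] @ u1"
  using assms(1)
proof (induction "length u" arbitrary: u rule: less_induct)
  case less
  consider "length u < length v" | "length u = length v" | "length u > length v" by linarith
  then show ?case
  proof cases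
    case 1
    then show ?thesis using less.prems by (intro exI[of _ u] exI[of _ 0]) simp
  next
    case 2
    then have "complement v = u" "u = v" using less.prems by simp_all
    then have "complement v = v" by simp
    then show ?thesis using complement_neq_self assms(2) by blast
  next
    case 3
    then obtain s where s: "u = v @ [A] @ s" "u = s @ [A] @ complement v"
      using append_Cons_eq_split[OF less.prems[symmetric] 3] by blast
    then have s2: "s @ [A] @ complement v = v @ [A] @ s" by simp
    obtain u1 k where "length u1 < length v" "s = u1 @ word_pow ([A] @ complement v) k"
      "u1 @ [A] @ complement v = v @ [A] @ u1"
      using less.hyps[OF _ s2] s(1) by auto
    then show ?thesis using s(2)
      by (intro exI[of _ u1] exI[of _ "Suc k"]) (simp add: word_pow_Suc_right)
  qed
qed

lemma commuting_A: "u @ [A] = [A] @ u \<Longrightarrow> u = word_pow [A] (length u)"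
  by (induction u) (auto simp: word_pow_Suc)

text \<open>The array is recovered from its last entry backwards: each division supplies one
  exponent \<open>k\<close>, and the shorter pair \<open>(u1, v1)\<close> supplies the entries
  before it.\<close>

lemma commuting_imp_gen:
  assumes "u @ [A] @ complement v = v @ [A] @ u"
    and "\<And>p. prefix p v \<Longrightarrow> delta p \<ge> 0"
  shows "\<exists>n t. length t = Suc n \<and> t ! 0 > 0 \<and>
               gen t n = (u, u @ [A] @ complement v @ [B] @ complement u)"
  using assms
proof (induction "length v" arbitrary: u v rule: less_induct)
  case less
  show ?case
  proof (cases "v = []")
    case True
    define k where "k = length u"
    have u: "u = word_pow [A] k" unfolding k_def using True less.prems(1) by (intro commuting_A) simp
    \<comment> \<open>The entry is \<open>Suc k\<close> since stage 0 uses the exponent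
      \<open>t ! 0 - 1\<close> for \<open>u\<close>; this also makes it positive.\<close>
    have "gen [Suc k] 0 = (u, u @ [A] @ complement v @ [B] @ complement u)"
      using True u by (simp add: complement_word_pow word_pow_Suc_right[of "[A]"] word_pow_Suc[of "[B]"])
    then show ?thesis by (intro exI[of _ 0] exI[of _ "[Suc k]"]) simp
  next
    case False
    obtain u1 k where u1: "length u1 < length v" "u = u1 @ word_pow ([A] @ complement v) k"
      and comm: "u1 @ [A] @ complement v = v @ [A] @ u1"
      using reduce_commuting[OF less.prems(1) False] by blast
    obtain z where z: "v = u1 @ [A] @ z" "complement v = z @ [A] @ u1"
      using append_Cons_eq_split[OF comm u1(1)] by blast
    \<comment> \<open>Together with \<open>cv\<close>, this is the factorization of a fixed point
      with \<open>x = complement z\<close> and \<open>y = complement u1\<close>, so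
      \<open>split_fixed_word\<close> applies to \<open>v\<close> itself.\<close>
    have v: "v = complement z @ [B] @ complement u1"
      using arg_cong[OF z(2), of complement] by simp
    have cv: "complement v = complement u1 @ [B] @ complement z" using z(1) by simp
    obtain v1 where v1: "complement z = u1 @ [A] @ complement v1" "complement z = v1 @ [A] @ u1"
      using split_fixed_word[OF v cv less.prems(2)] by auto
    have "prefix v1 v" "length v1 < length v" using v v1(2) by auto
    then obtain n t where t: "length t = Suc n" "t ! 0 > 0"
      "gen t n = (u1, u1 @ [A] @ complement v1 @ [B] @ complement u1)"
      using less.hyps[of v1 u1] less.prems(2) v1 prefix_order.trans by metis
    have gent: "gen t n = (u1, v)" using t(3) v v1(1) by simp
    have "gen (t @ [k]) (Suc n) = (u, u @ [A] @ complement v @ [B] @ Sym u)"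
    proof -
      have "rev u1 = u1" using gen_invariant[OF t(2) gent] by simp
      then show ?thesis using gen_append[of n t "[k]"] t(1) gent u1(2)
        by (simp add: Let_def nth_append)
    qed
    moreover have pos: "(t @ [k]) ! 0 > 0" using t by (simp add: nth_append)
    moreover have "Sym u = complement u"
      using gen_invariant[OF pos calculation(1)] by (metis Sym_def complement_rev)
    ultimately show ?thesis using t(1) by (intro exI[of _ "Suc n"] exI[of _ "t @ [k]"]) simp
  qed
qed

lemma F_gamma_imp_gen:
  assumes "w \<in> F_gamma"
  shows "\<exists>n t. length t = Suc n \<and> t ! 0 > 0 \<and> w = snd (gen t n)"
proof -
  obtain m where m: "m \<ge> 1" "dyck_word m w" "gamma m (w @ [B]) = w @ [B]"
    using assms by (auto simp: F_gamma_def)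
  obtain x y where xy: "w = x @ [B] @ y" "complement w = y @ [B] @ x"
    using gamma_fixed_iff[OF m(2,1)] m(3) by blast
  have nonneg: "delta p \<ge> 0" if "prefix p w" for p
    using m(2) that by (auto simp: dyck_word_def)
  obtain u v where uv: "y = complement u" "x = u @ [A] @ complement v" "x = v @ [A] @ u"
    using split_fixed_word[OF xy nonneg] by blast
  \<comment> \<open>The heights of \<open>v\<close> are thus nonnegative, as the descent
    requires.\<close>
  have "prefix v w" using xy uv(3) by simp
  then have "delta p \<ge> 0" if "prefix p v" for p
    using nonneg that prefix_order.trans by blast
  then obtain n t where "length t = Suc n" "t ! 0 > 0"
    "gen t n = (u, u @ [A] @ complement v @ [B] @ complement u)"
    using commuting_imp_gen[of u v] uv by metis
  then show ?thesis using xy uv by force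
qed

theorem theorem4p1:
  fixes w :: word
  shows "w \<in> F_gamma \<longleftrightarrow>
    (\<exists>(n::nat) (t::nat list). length t = n + 1 \<and> t ! 0 > 0 \<and> w = GenGammaPath t)"
proof
  assume "w \<in> F_gamma"
  then show "\<exists>n t. length t = n + 1 \<and> t ! 0 > 0 \<and> w = GenGammaPath t"
    using F_gamma_imp_gen by (fastforce simp: GenGammaPath_eq)
next
  assume "\<exists>n t. length t = n + 1 \<and> t ! 0 > 0 \<and> w = GenGammaPath t"
  then show "w \<in> F_gamma" using gen_in_F_gamma by (auto simp: GenGammaPath_eq)
qed

end
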